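(* Let $f=\phi+g$ be a composite convex function with nonempty set of minimizers $X^*$ and minimum value $f^*$, let $x_0\in\operatorname{dom} f$, and let $K=\{x: f(x)\le f(x_0)\}$. Assume that $\phi\in\mathcal{H}_{s,L,\|\cdot\|}$ for a given norm $\|\cdot\|$ on $\mathbb{R}^n$, $1\le s\le2$ and $L>0$, that $f\in\mathcal{L}_{r,\mu,h}(K)$ for some $r\ge 1$, $\mu>0$ and $h$ strongly convex with respect to $\|\cdot\|$ (with parameter one), and that $g$ is simple. Put $\rho=\frac{3s}{2}-1$, $\kappa=L^{2/s}/\mu^{2/r}$, $\tau=1-s/r$, assumed to lie in $[0,1)$, and $c=16e^{2/e}$. Let $\epsilon_0>0$ with $\epsilon_0\ge f(x_0)-f^*$, let $R\ge1$, and run, for $k=1,\dots,R$, $$\epsilon_k=e^{-\rho}\epsilon_{k-1},\qquad x_k=\mathcal{U}(x_{k-1},\epsilon_k,t_k),\qquad t_k=C^*_{\kappa,\tau,\rho}e^{\tau k},\qquad C^*_{\kappa,\tau,\rho}=e^{1-\tau}(c\kappa)^{\frac{s}{2\rho}}\epsilon_0^{-\frac{\tau}{\rho}}.$$ Let $\hat x=x_R$ and $N=\sum_{k=1}^R t_k$. Then, when $\tau=0$, $$f(\hat x)-f^*\le\exp\left(-\rho e^{-1}(c\kappa)^{-\frac{s}{2\rho}}N\right)\epsilon_0,$$ and, when $\tau>0$, $$f(\hat x)-f^*\le\frac{\epsilon_0}{\left(\tau e^{-1}(c\kappa)^{-\frac{s}{2\rho}}\epsilon_0^{\frac{\tau}{\rho}}N+1\right)^{\frac{\rho}{\tau}}},$$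 which is $O(N^{-\rho/\tau})$ as $N\to\infty$.
   Context: Setting: $\phi,g$ are convex functions on $\mathbb{R}^n$, $\phi$ being defined on an open set containing $\operatorname{dom} g$, so $\operatorname{dom} f=\operatorname{dom} g$. $\mathcal{H}_{s,L,\|\cdot\|}$ is the set of functions $\phi$ with $\|\nabla\phi(x)-\nabla\phi(y)\|_*\le L\|x-y\|^{s-1}$ for all $x,y\in\operatorname{dom}\phi$ and any subgradients $\nabla\phi(x)\in\partial\phi(x)$, $\nabla\phi(y)\in\partial\phi(y)$, where $\|\cdot\|_*$ is the dual norm. The potential function $h$, with $\operatorname{dom} f\subset\operatorname{dom} h$, is differentiable and satisfies $h(y)\ge h(x)+\nabla h(x)^T(y-x)+\frac12\|x-y\|^2$ for all $x,y\in\operatorname{dom} h$. Its Bregman divergence is $D_h(y;x)=h(y)-h(x)-\nabla h(x)^T(y-x)$, and $D_h(x,X^* )=\min_{x^*\in X^*}D_h(x^*;x)$. $g$ simple means: for any $x,y\in\operatorname{dom} f$ and $\lambda\ge0$ the problem $\min_z\{y^Tz+g(z)+\lambda D_h(z;x)\}$ can be solved in closed form or by a fast procedure (only needed so that $\mathcal{U}$ is implementable). $\mathcal{L}_{r,\mu,h}(K)$ is the set of functions $f$ with $\frac{\mu}{r}D_h(x,X^* )^{r/2}\le f(x)-f^*$ for all $x\in K$ (relative Łojasiewicz growth condition). $\mathcal{U}$ denotes the (monotone) universal fast gradient method for this setting: from a starting point $x$, a target accuracy $\epsilon>0$ and a number of iterations $t>0$ it outputs $y=\mathcal{U}(x,\epsilon,t)$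 with $$f(y)-f^*\le\frac{\epsilon}{2}+\frac{c_0L^{2/s}D_h(x,X^* )}{\epsilon^{2/s}t^{2\rho/s}}\,\frac{\epsilon}{2},\qquad c_0=2^{\frac{5s-2}{s}},\qquad\text{and}\qquad f(y)\le f(x).$$ Any method with these guarantees may be used. Iteration counts are treated as positive real numbers (rounding to integers is ignored). *)

theory Defs
  imports "HOL-Analysis.Analysis" "HOL-Library.Landau_Symbols"
begin

(* A convex function with domain D is a real-valued function f together with the set D; its
   values outside D carry no meaning, and every notion below only looks at points of D. *)

definition is_norm :: "(real^'n \<Rightarrow> real) \<Rightarrow> bool" where
  "is_norm nrm \<longleftrightarrow>
     (\<forall>x. nrm x = 0 \<longleftrightarrow> x = 0) \<and>
     (\<forall>a x. nrm (a *\<^sub>R x) = \<bar>a\<bar> * nrm x) \<and>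
     (\<forall>x y. nrm (x + y) \<le> nrm x + nrm y)"

definition dual_norm :: "(real^'n \<Rightarrow> real) \<Rightarrow> real^'n \<Rightarrow> real" where
  "dual_norm nrm v = (SUP x\<in>{x. nrm x \<le> 1}. v \<bullet> x)"

definition subdifferential :: "(real^'n) set \<Rightarrow> (real^'n \<Rightarrow> real) \<Rightarrow> real^'n \<Rightarrow> (real^'n) set" where
  "subdifferential D f x = {v. \<forall>y\<in>D. f y \<ge> f x + v \<bullet> (y - x)}"

(* The library has 0 powr 0 = 0. In the Hoelder condition with s = 1 the factor
   nrm (x - y) powr (s - 1) has to be 1 also for x = y; otherwise nonsmooth functions would be
   excluded, because two different subgradients at one point would be forced to coincide. *)
definition rpow :: "real \<Rightarrow> real \<Rightarrow> real" where
  "rpow a p = (if p = 0 then 1 else a powr p)"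

definition holder_class ::
  "real \<Rightarrow> real \<Rightarrow> (real^'n \<Rightarrow> real) \<Rightarrow> (real^'n) set \<Rightarrow> (real^'n \<Rightarrow> real) \<Rightarrow> bool" where
  "holder_class s L nrm D \<phi> \<longleftrightarrow>
     (\<forall>x\<in>D. \<forall>y\<in>D. \<forall>u\<in>subdifferential D \<phi> x. \<forall>v\<in>subdifferential D \<phi> y.
        dual_norm nrm (u - v) \<le> L * rpow (nrm (x - y)) (s - 1))"

(* gh is the gradient of h on its domain D; differentiability is taken relative to D, so D need
   not be open. *)
definition potential ::
  "(real^'n \<Rightarrow> real) \<Rightarrow> (real^'n) set \<Rightarrow> (real^'n \<Rightarrow> real) \<Rightarrow> (real^'n \<Rightarrow> real^'n) \<Rightarrow> bool" where
  "potential nrm D h gh \<longleftrightarrow>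
     (\<forall>x\<in>D. (h has_derivative (\<lambda>v. gh x \<bullet> v)) (at x within D)) \<and>
     (\<forall>x\<in>D. \<forall>y\<in>D. h y \<ge> h x + gh x \<bullet> (y - x) + 1 / 2 * (nrm (x - y))\<^sup>2)"

(* bregman h gh y x is D_h(y;x) *)
definition bregman ::
  "(real^'n \<Rightarrow> real) \<Rightarrow> (real^'n \<Rightarrow> real^'n) \<Rightarrow> real^'n \<Rightarrow> real^'n \<Rightarrow> real" where
  "bregman h gh y x = h y - h x - gh x \<bullet> (y - x)"

(* D_h(x,X), with the minimum over z in X written as an infimum: the Bregman divergences are
   nonnegative on the domain of h, so it is the minimum whenever that is attained. *)
definition bregman_set ::
  "(real^'n \<Rightarrow> real) \<Rightarrow> (real^'n \<Rightarrow> real^'n) \<Rightarrow> real^'n \<Rightarrow> (real^'n) set \<Rightarrow> real" where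
  "bregman_set h gh x X = (INF z\<in>X. bregman h gh z x)"

definition minimizers :: "(real^'n) set \<Rightarrow> (real^'n \<Rightarrow> real) \<Rightarrow> (real^'n) set" where
  "minimizers D f = {x. is_arg_min f (\<lambda>z. z \<in> D) x}"

definition min_value :: "(real^'n) set \<Rightarrow> (real^'n \<Rightarrow> real) \<Rightarrow> real" where
  "min_value D f = (INF x\<in>D. f x)"

definition rel_lojasiewicz ::
  "real \<Rightarrow> real \<Rightarrow> (real^'n \<Rightarrow> real) \<Rightarrow> (real^'n \<Rightarrow> real^'n) \<Rightarrow> (real^'n) set \<Rightarrow>
   (real^'n) set \<Rightarrow> (real^'n \<Rightarrow> real) \<Rightarrow> bool" where
  "rel_lojasiewicz r \<mu> h gh K D f \<longleftrightarrow>
     (\<forall>x\<in>K. \<mu> / r * bregman_set h gh x (minimizers D f) powr (r / 2) \<le> f x - min_value D f)"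

(* U x \<epsilon> t is the output for starting point x, target accuracy \<epsilon> and t iterations, where t is
   treated as a positive real number. *)
definition universal_fast_gradient ::
  "real \<Rightarrow> real \<Rightarrow> (real^'n \<Rightarrow> real) \<Rightarrow> (real^'n \<Rightarrow> real^'n) \<Rightarrow> (real^'n) set \<Rightarrow>
   (real^'n \<Rightarrow> real) \<Rightarrow> (real^'n \<Rightarrow> real \<Rightarrow> real \<Rightarrow> real^'n) \<Rightarrow> bool" where
  "universal_fast_gradient s L h gh D f U \<longleftrightarrow>
     (\<forall>x\<in>D. \<forall>\<epsilon>>0. \<forall>t>0.
        U x \<epsilon> t \<in> D \<and>
        f (U x \<epsilon> t) - min_value D f \<le>
          \<epsilon> / 2 +
          2 powr ((5 * s - 2) / s) * L powr (2 / s) * bregman_set h gh x (minimizers D f)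
            / (\<epsilon> powr (2 / s) * t powr (2 * (3 * s / 2 - 1) / s)) * (\<epsilon> / 2) \<and>
        f (U x \<epsilon> t) \<le> f x)"

end

theory Submission
  imports Defs
begin

text \<open>
  By the growth condition, a gap \<open>f x - f* \<le> E\<close> bounds the distance \<open>D\<^sub>h(x,X*)\<close> by
  \<open>(r E / \<mu>)\<^bsup>2/r\<^esup>\<close>. Inserting \<open>E = e\<^bsup>\<rho>\<^esup> \<epsilon>\<^sub>k\<close> into the guarantee of \<open>\<U>\<close>,
  the number \<open>t\<^sub>k = e\<^bsup>1-\<tau>\<^esup> (c \<kappa>)\<^bsup>s/(2\<rho>)\<^esup> \<epsilon>\<^sub>k\<^bsup>-\<tau>/\<rho>\<^esup>\<close> of iterations is just what makes
  the second term at most \<open>\<epsilon>\<^sub>k/2\<close>, because \<open>r\<^bsup>2/r\<^esup> \<le> e\<^bsup>2/e\<^esup>\<close> and \<open>c\<^sub>0 \<le> 16\<close>. Hence every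
  restart reduces the gap by the factor \<open>e\<^bsup>-\<rho>\<^esup>\<close>. The rates follow by expressing \<open>e\<^bsup>-\<rho>R\<^esup>\<close>
  through the geometric sum \<open>N\<close>, with \<open>e\<^bsup>\<tau>\<^esup> - 1 \<ge> \<tau>\<close>.
\<close>

text \<open>The tangent line of \<open>ln\<close> at e gives \<open>ln r \<le> r / exp 1\<close>,
  with equality only at r = e. This bound is the source of the factor \<open>exp (2 / exp 1)\<close>
  in \<open>c\<close>.\<close>

lemma powr_inverse_self_le:
  fixes r :: real
  assumes "r > 0"
  shows "r powr (2 / r) \<le> exp (2 / exp 1)"
proof -
  have "ln (r / exp 1) \<le> r / exp 1 - 1"
    using assms by (intro ln_le_minus_one) simp
  then have "ln r \<le> r / exp 1"
    using assms by (simp add: ln_div)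
  then have "2 / r * ln r \<le> 2 / r * (r / exp 1)"
    using assms by (intro mult_left_mono) auto
  also have "\<dots> = 2 / exp 1"
    using assms by simp
  finally show ?thesis
    using assms by (simp add: powr_def)
qed

text \<open>Strong convexity bounds each divergence below by half a squared norm; as
  \<open>X\<close> is nonempty, the bound passes to the infimum.\<close>

lemma bregman_set_nonneg:
  assumes "is_norm nrm" "potential nrm D h gh" "x \<in> D" "X \<subseteq> D" "X \<noteq> {}"
  shows "bregman_set h gh x X \<ge> 0"
  unfolding bregman_set_def
proof (rule cINF_greatest)
  fix z assume "z \<in> X"
  then have "h z \<ge> h x + gh x \<bullet> (z - x) + 1 / 2 * (nrm (x - z))\<^sup>2"
    using assms unfolding potential_def by blast
  moreover have "1 / 2 * (nrm (x - z))\<^sup>2 \<ge> 0"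
    by simp
  ultimately show "0 \<le> bregman h gh z x"
    unfolding bregman_def by linarith
qed (fact assms)

text \<open>Read \<open>\<epsilon>\<close> as the accuracy of the current stage,
  \<open>exp \<rho> * \<epsilon>\<close> as that of the previous one, and \<open>d\<close> as the
  distance of the previous iterate to the minimizers. Both sides of the fraction are compared with
  \<open>c * \<kappa> * P\<close>: the numerator is at most this, the denominator equals it by the
  choice of \<open>t\<close>.\<close>

lemma restart_ratio_le_one:
  fixes s L r \<mu> \<rho> \<tau> \<epsilon> d :: real
  defines "\<kappa> \<equiv> L powr (2 / s) / \<mu> powr (2 / r)"
    and "c \<equiv> 16 * exp (2 / exp 1)"
  assumes s: "1 \<le> s" "s \<le> 2" and pos: "L > 0" "r > 0" "\<mu> > 0" "\<rho> > 0" "\<epsilon> > 0"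
    and \<tau>: "\<tau> = 1 - s / r"
    and d: "d \<ge> 0" "\<mu> / r * d powr (r / 2) \<le> exp \<rho> * \<epsilon>"
    and t: "t = exp (1 - \<tau>) * (c * \<kappa>) powr (s / (2 * \<rho>)) * \<epsilon> powr (- \<tau> / \<rho>)"
  shows "2 powr ((5 * s - 2) / s) * L powr (2 / s) * d
           / (\<epsilon> powr (2 / s) * t powr (2 * \<rho> / s)) \<le> 1"
proof -
  define P where "P = (exp \<rho> * \<epsilon>) powr (2 / r)"
  have "c * \<kappa> > 0"
    using pos by (simp add: c_def \<kappa>_def)
  have "P > 0"
    using pos by (simp add: P_def)
  have "d powr (r / 2) \<le> r / \<mu> * (exp \<rho> * \<epsilon>)"
    using d(2) pos by (simp add: field_simps)
  then have "(d powr (r / 2)) powr (2 / r) \<le> (r / \<mu> * (exp \<rho> * \<epsilon>)) powr (2 / r)"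
    using pos by (intro powr_mono2) auto
  also have "\<dots> = r powr (2 / r) / \<mu> powr (2 / r) * P"
    using pos by (simp add: P_def powr_mult powr_divide)
  also have "\<dots> \<le> exp (2 / exp 1) / \<mu> powr (2 / r) * P"
    using pos \<open>P > 0\<close> by (intro mult_right_mono divide_right_mono powr_inverse_self_le) auto
  \<comment> \<open>The exponents r/2 and 2/r cancel, and \<open>d \<ge> 0\<close> turns
    \<open>d powr 1\<close> into \<open>d\<close>.\<close>
  finally have d_le: "d \<le> exp (2 / exp 1) / \<mu> powr (2 / r) * P"
    using pos d(1) by (simp add: powr_powr)
  \<comment> \<open>The quotient is 5 - 2/s, which is largest at s = 2; hence the factor 16 in
    \<open>c\<close>.\<close>
  have "(5 * s - 2) / s \<le> 4"
    using s by (simp add: field_simps)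
  then have "2 powr ((5 * s - 2) / s) \<le> 2 powr (4 :: real)"
    by (intro powr_mono) auto
  then have c0_le: "2 powr ((5 * s - 2) / s) \<le> (16 :: real)"
    by simp
  have num: "2 powr ((5 * s - 2) / s) * L powr (2 / s) * d \<le> c * \<kappa> * P"
  proof -
    have "2 powr ((5 * s - 2) / s) * L powr (2 / s) * d
        \<le> 16 * L powr (2 / s) * (exp (2 / exp 1) / \<mu> powr (2 / r) * P)"
      using c0_le d_le d(1) by (intro mult_mono) auto
    then show ?thesis
      by (simp add: c_def \<kappa>_def mult_ac)
  qed
  \<comment> \<open>All three rest on 1 - \<tau> = s/r. The first and third produce the common
    exponent 2/r of \<open>P\<close>; the second makes the power of \<open>c * \<kappa>\<close>
    equal to one.\<close>
  have exps: "(1 - \<tau>) * (2 * \<rho> / s) = \<rho> * (2 / r)" "s / (2 * \<rho>) * (2 * \<rho> / s) = 1"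
    "2 / s + (- \<tau> / \<rho>) * (2 * \<rho> / s) = 2 / r"
    using s pos by (auto simp: \<tau> field_simps)
  have "t powr (2 * \<rho> / s)
      = exp ((1 - \<tau>) * (2 * \<rho> / s)) * (c * \<kappa>) powr (s / (2 * \<rho>) * (2 * \<rho> / s))
        * \<epsilon> powr ((- \<tau> / \<rho>) * (2 * \<rho> / s))"
    using pos by (simp only: t powr_mult powr_powr) (simp add: powr_def)
  then have "\<epsilon> powr (2 / s) * t powr (2 * \<rho> / s)
      = exp (\<rho> * (2 / r)) * (c * \<kappa>) * \<epsilon> powr (2 / s + (- \<tau> / \<rho>) * (2 * \<rho> / s))"
    unfolding exps(1,2) powr_add using \<open>c * \<kappa> > 0\<close> by simp
  also have "\<dots> = c * \<kappa> * P"
    unfolding exps(3) using pos by (simp add: P_def powr_mult) (simp add: powr_def)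
  finally have "\<epsilon> powr (2 / s) * t powr (2 * \<rho> / s) = c * \<kappa> * P" .
  moreover have "c * \<kappa> * P > 0"
    using \<open>c * \<kappa> > 0\<close> \<open>P > 0\<close> by (rule mult_pos_pos)
  ultimately show ?thesis
    using num by (simp add: pos_divide_le_eq)
qed

text \<open>Induction avoids the closed form of the geometric sum and its division by zero at
  \<open>\<tau> = 0\<close>; each step loses only 1 + \<tau> \<le> exp \<tau>. The factor
  \<open>exp (- \<tau>)\<close> compensates for the sum starting at k = 1.\<close>

lemma geometric_sum_exp_le:
  fixes \<tau> :: real
  shows "\<tau> * exp (- \<tau>) * (\<Sum>k=1..n. exp (\<tau> * real k)) + 1 \<le> exp (\<tau> * real n)"
proof (induction n)
  case (Suc n)
  have "exp (- \<tau>) * exp (\<tau> * real (Suc n)) = exp (\<tau> * real n)"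
    by (simp add: algebra_simps flip: exp_add)
  then have "\<tau> * exp (- \<tau>) * (\<Sum>k=1..Suc n. exp (\<tau> * real k)) + 1
      = (\<tau> * exp (- \<tau>) * (\<Sum>k=1..n. exp (\<tau> * real k)) + 1) + \<tau> * exp (\<tau> * real n)"
    by (simp add: distrib_left mult.assoc)
  also have "\<dots> \<le> (1 + \<tau>) * exp (\<tau> * real n)"
    using Suc.IH by (simp add: algebra_simps)
  also have "\<dots> \<le> exp \<tau> * exp (\<tau> * real n)"
    by (intro mult_right_mono exp_ge_add_one_self) auto
  also have "\<dots> = exp (\<tau> * real (Suc n))"
    by (simp add: algebra_simps flip: exp_add)
  finally show ?case .
qed simp

text \<open>For M > 0, dropping the summand 1 shrinks the denominator, which gives the constant
  \<open>\<bar>b\<bar> / a powr p\<close>.\<close>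

lemma inverse_affine_powr_bigo:
  fixes a b p :: real
  assumes "a > 0" "p \<ge> 0"
  shows "(\<lambda>M. b / (a * M + 1) powr p) \<in> O[at_top](\<lambda>M. M powr (- p))"
proof (rule bigoI)
  show "\<forall>\<^sub>F M in at_top. norm (b / (a * M + 1) powr p) \<le> \<bar>b\<bar> / a powr p * norm (M powr (- p))"
    using eventually_gt_at_top[of 0]
  proof eventually_elim
    case (elim M)
    have "a * M > 0"
      using assms elim by simp
    then have "(a * M) powr p \<le> (a * M + 1) powr p"
      using assms by (intro powr_mono2) auto
    then have "\<bar>b\<bar> / (a * M + 1) powr p \<le> \<bar>b\<bar> / (a * M) powr p"
      using \<open>a * M > 0\<close> by (intro divide_left_mono mult_pos_pos) auto
    also have "\<dots> = \<bar>b\<bar> / a powr p * M powr (- p)"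
      using assms elim by (simp add: powr_mult powr_minus field_simps)
    finally show ?case
      by simp
  qed
qed

theorem corollary5p4:
  fixes nrm :: "real^'n \<Rightarrow> real"
    and \<phi> g f h :: "real^'n \<Rightarrow> real"
    and gh :: "real^'n \<Rightarrow> real^'n"
    and dom_\<phi> dom_g dom_h K :: "(real^'n) set"
    and U :: "real^'n \<Rightarrow> real \<Rightarrow> real \<Rightarrow> real^'n"
    and x0 xhat :: "real^'n"
    and x :: "nat \<Rightarrow> real^'n"
    and eps t :: "nat \<Rightarrow> real"
    and s L r \<mu> \<rho> \<kappa> \<tau> c C eps0 fstar N :: real
    and R :: nat
  assumes "is_norm nrm"
    and "open dom_\<phi>" and "dom_g \<subseteq> dom_\<phi>"
    and "convex_on dom_\<phi> \<phi>" and "convex_on dom_g g"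
    and "f = (\<lambda>z. \<phi> z + g z)"
    and "minimizers dom_g f \<noteq> {}"
    and "fstar = min_value dom_g f"
    and "x0 \<in> dom_g"
    and "K = {z \<in> dom_g. f z \<le> f x0}"
    and "1 \<le> s" and "s \<le> 2" and "L > 0"
    and "holder_class s L nrm dom_\<phi> \<phi>"
    and "dom_g \<subseteq> dom_h"
    and "potential nrm dom_h h gh"
    and "r \<ge> 1" and "\<mu> > 0"
    and "rel_lojasiewicz r \<mu> h gh K dom_g f"
    and "universal_fast_gradient s L h gh dom_g f U"
    and "\<rho> = 3 * s / 2 - 1"
    and "\<kappa> = L powr (2 / s) / \<mu> powr (2 / r)"
    and "\<tau> = 1 - s / r" and "0 \<le> \<tau>" and "\<tau> < 1"
    and "c = 16 * exp (2 / exp 1)"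
    and "eps0 > 0" and "eps0 \<ge> f x0 - fstar"
    and "R \<ge> 1"
    and "C = exp (1 - \<tau>) * (c * \<kappa>) powr (s / (2 * \<rho>)) * eps0 powr (- \<tau> / \<rho>)"
    and "x 0 = x0" and "eps 0 = eps0"
    and "\<forall>k\<in>{1..R}. eps k = exp (- \<rho>) * eps (k - 1)"
    and "\<forall>k\<in>{1..R}. t k = C * exp (\<tau> * real k)"
    and "\<forall>k\<in>{1..R}. x k = U (x (k - 1)) (eps k) (t k)"
    and "xhat = x R"
    and "N = (\<Sum>k=1..R. t k)"
  shows "(\<tau> = 0 \<longrightarrow>
           f xhat - fstar \<le> exp (- \<rho> * exp (- 1) * (c * \<kappa>) powr (- s / (2 * \<rho>)) * N) * eps0)
       \<and> (\<tau> > 0 \<longrightarrow>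
           f xhat - fstar \<le>
             eps0 / (\<tau> * exp (- 1) * (c * \<kappa>) powr (- s / (2 * \<rho>)) * eps0 powr (\<tau> / \<rho>) * N + 1)
                    powr (\<rho> / \<tau>))
       \<and> (\<tau> > 0 \<longrightarrow>
           (\<lambda>M::real. eps0 / (\<tau> * exp (- 1) * (c * \<kappa>) powr (- s / (2 * \<rho>)) * eps0 powr (\<tau> / \<rho>) * M + 1)
                    powr (\<rho> / \<tau>))
             \<in> O[at_top](\<lambda>M. M powr (- \<rho> / \<tau>)))"
proof -
  note norm = assms(1) and f_min = assms(7) and fstar = assms(8) and x0 = assms(9) and K = assms(10)
    and s = assms(11,12) and L = assms(13) and dom_h = assms(15) and pot = assms(16)
    and r = assms(17) and \<mu> = assms(18) and growth = assms(19) and U = assms(20) and \<rho> = assms(21)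
    and \<kappa> = assms(22) and \<tau> = assms(23) and c = assms(26) and eps0 = assms(27,28)
    and C = assms(30) and x_0 = assms(31) and eps_0 = assms(32) and eps_step = assms(33)
    and t = assms(34) and x_step = assms(35) and xhat = assms(36) and N = assms(37)
  have pos: "\<rho> > 0" "r > 0" "\<kappa> > 0" "c > 0"
    using s L r \<mu> by (auto simp: \<rho> \<kappa> c)
  have eps: "eps k = exp (- \<rho> * real k) * eps0" if "k \<le> R" for k
    using that
  proof (induction k)
    case (Suc k)
    then have "eps (Suc k) = exp (- \<rho>) * eps k"
      using eps_step by auto
    then show ?case
      using Suc by (simp add: algebra_simps flip: exp_add)
  qed (simp add: eps_0)
  have eps_pos: "eps k > 0" if "k \<le> R" for k
    using eps[OF that] eps0(1) by simp
  \<comment> \<open>Since \<open>exp (\<tau> * real k)\<close> is the power -\<tau>/\<rho> of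
    \<open>exp (- \<rho> * real k)\<close>, the count depends on k only through
    \<open>eps k\<close>, as \<open>restart_ratio_le_one\<close> requires.\<close>
  have t_eps: "t k = exp (1 - \<tau>) * (c * \<kappa>) powr (s / (2 * \<rho>)) * eps k powr (- \<tau> / \<rho>)"
    if "k \<in> {1..R}" for k
  proof -
    have "eps k powr (- \<tau> / \<rho>) = exp (- \<rho> * real k) powr (- \<tau> / \<rho>) * eps0 powr (- \<tau> / \<rho>)"
      using that eps0(1) by (simp add: eps powr_mult)
    also have "exp (- \<rho> * real k) powr (- \<tau> / \<rho>) = exp (\<tau> * real k)"
      using pos by (simp add: powr_def)
    finally show ?thesis
      using t that by (simp add: C)
  qed
  have min_sub: "minimizers dom_g f \<subseteq> dom_h"
    using dom_h by (auto simp: minimizers_def is_arg_min_def)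
  \<comment> \<open>Membership in \<open>K\<close> is carried along because the growth condition
    holds only there; monotonicity of \<open>U\<close> preserves it.\<close>
  have gap: "x k \<in> K \<and> f (x k) - fstar \<le> eps k" if "k \<le> R" for k
    using that
  proof (induction k)
    case 0
    then show ?case
      using x0 eps0 by (simp add: x_0 eps_0 K)
  next
    case (Suc k)
    define d where "d = bregman_set h gh (x k) (minimizers dom_g f)"
    have k: "Suc k \<in> {1..R}"
      using Suc.prems by simp
    have IH: "x k \<in> dom_g" "f (x k) \<le> f x0" "f (x k) - fstar \<le> eps k"
      using Suc by (auto simp: K)
    have t_pos: "t (Suc k) > 0"
      using t_eps[OF k] pos eps_pos[OF Suc.prems] by simp
    have "x (Suc k) = U (x k) (eps (Suc k)) (t (Suc k))"
      using x_step k by simp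
    then have U_step: "x (Suc k) \<in> dom_g" "f (x (Suc k)) \<le> f (x k)"
      "f (x (Suc k)) - fstar \<le> eps (Suc k) / 2 +
         2 powr ((5 * s - 2) / s) * L powr (2 / s) * d
           / (eps (Suc k) powr (2 / s) * t (Suc k) powr (2 * \<rho> / s)) * (eps (Suc k) / 2)"
      using U IH(1) eps_pos[OF Suc.prems] t_pos
      unfolding universal_fast_gradient_def d_def fstar \<rho> by auto
    have "d \<ge> 0"
      unfolding d_def using norm pot IH(1) dom_h min_sub f_min
      by (intro bregman_set_nonneg[of nrm dom_h]) auto
    moreover have "\<mu> / r * d powr (r / 2) \<le> exp \<rho> * eps (Suc k)"
    proof -
      have "\<mu> / r * d powr (r / 2) \<le> f (x k) - fstar"
        using growth IH unfolding rel_lojasiewicz_def d_def fstar K by auto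
      also have "\<dots> \<le> eps k"
        by (fact IH)
      also have "\<dots> = exp \<rho> * eps (Suc k)"
        using eps_step k by (simp flip: exp_add mult.assoc)
      finally show ?thesis .
    qed
    ultimately have "2 powr ((5 * s - 2) / s) * L powr (2 / s) * d
        / (eps (Suc k) powr (2 / s) * t (Suc k) powr (2 * \<rho> / s)) \<le> 1"
      using s L pos \<mu> \<tau> eps_pos[OF Suc.prems] t_eps[OF k]
      unfolding c \<kappa> by (intro restart_ratio_le_one)
    \<comment> \<open>The second term of the guarantee is the ratio times half the accuracy, so both
      terms together are at most \<open>eps (Suc k)\<close>.\<close>
    from mult_right_mono[OF this, of "eps (Suc k) / 2"]
    have "f (x (Suc k)) - fstar \<le> eps (Suc k)"
      using U_step(3) eps_pos[OF Suc.prems] by linarith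
    then show ?case
      using U_step(1,2) IH(2) by (simp add: K)
  qed
  have gap_R: "f xhat - fstar \<le> exp (- \<rho> * real R) * eps0"
    using gap[of R] eps[of R] by (simp add: xhat)
  have N_C: "N = C * (\<Sum>k=1..R. exp (\<tau> * real k))"
    using t by (simp add: N sum_distrib_left)
  have cancel: "(c * \<kappa>) powr (- s / (2 * \<rho>)) * (c * \<kappa>) powr (s / (2 * \<rho>)) = 1"
    using pos by (simp flip: powr_add)
  have cancel_eps: "eps0 powr (\<tau> / \<rho>) * eps0 powr (- \<tau> / \<rho>) = 1"
    using eps0(1) by (simp flip: powr_add)
  \<comment> \<open>The prefactors in both rates undo the normalisation of \<open>C\<close>; only
    exp (-1) times exp (1 - \<tau>) survives.\<close>
  have exp_C: "exp (- 1) * (c * \<kappa>) powr (- s / (2 * \<rho>)) * eps0 powr (\<tau> / \<rho>) * C = exp (- \<tau>)"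
  proof -
    have "exp (- 1) * (c * \<kappa>) powr (- s / (2 * \<rho>)) * eps0 powr (\<tau> / \<rho>) * C
        = (exp (- 1) * exp (1 - \<tau>))
          * ((c * \<kappa>) powr (- s / (2 * \<rho>)) * (c * \<kappa>) powr (s / (2 * \<rho>)))
          * (eps0 powr (\<tau> / \<rho>) * eps0 powr (- \<tau> / \<rho>))"
      unfolding C by (simp only: mult_ac)
    then show ?thesis
      unfolding cancel cancel_eps by (simp flip: exp_add)
  qed
  define a where "a = \<tau> * exp (- 1) * (c * \<kappa>) powr (- s / (2 * \<rho>)) * eps0 powr (\<tau> / \<rho>)"
  show ?thesis
    unfolding a_def[symmetric]
  proof (intro conjI impI)
    assume "\<tau> = 0"
    \<comment> \<open>Here every stage has the same length \<open>C\<close>, the sum is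
      \<open>real R\<close>, and \<open>eps0 powr 0\<close> is 1 because \<open>eps0\<close> is
      positive.\<close>
    then have "exp (- 1) * (c * \<kappa>) powr (- s / (2 * \<rho>)) * N = real R"
      using exp_C eps0(1) by (simp add: N_C mult.assoc[symmetric])
    then have "- \<rho> * exp (- 1) * (c * \<kappa>) powr (- s / (2 * \<rho>)) * N = - \<rho> * real R"
      by (metis mult.assoc)
    then show "f xhat - fstar \<le> exp (- \<rho> * exp (- 1) * (c * \<kappa>) powr (- s / (2 * \<rho>)) * N) * eps0"
      using gap_R by metis
  next
    assume "\<tau> > 0"
    have "a * N = \<tau> * (exp (- 1) * (c * \<kappa>) powr (- s / (2 * \<rho>)) * eps0 powr (\<tau> / \<rho>) * C)
        * (\<Sum>k=1..R. exp (\<tau> * real k))"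
      unfolding a_def N_C by (simp only: mult.assoc)
    then have "a * N + 1 \<le> exp (\<tau> * real R)"
      unfolding exp_C using geometric_sum_exp_le[of \<tau> R] by simp
    moreover have "a * N + 1 > 0"
    proof -
      have "a \<ge> 0" "N \<ge> 0"
        using \<open>\<tau> > 0\<close> by (auto simp: a_def N_C C intro!: mult_nonneg_nonneg sum_nonneg)
      then show ?thesis
        by (simp add: add_nonneg_pos)
    qed
    \<comment> \<open>Raising to the power \<rho>/\<tau> converts the growth rate \<tau> of the
      iteration counts into the decay rate \<rho> of the accuracies.\<close>
    ultimately have "(a * N + 1) powr (\<rho> / \<tau>) \<le> exp (\<tau> * real R) powr (\<rho> / \<tau>)"
      using \<open>\<tau> > 0\<close> pos by (intro powr_mono2) auto
    also have "\<dots> = exp (\<rho> * real R)"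
      using \<open>\<tau> > 0\<close> by (simp add: powr_def)
    finally have "eps0 / exp (\<rho> * real R) \<le> eps0 / (a * N + 1) powr (\<rho> / \<tau>)"
      using eps0(1) \<open>a * N + 1 > 0\<close> by (intro divide_left_mono) auto
    moreover have "exp (- \<rho> * real R) * eps0 = eps0 / exp (\<rho> * real R)"
      by (simp add: exp_minus field_simps)
    ultimately show "f xhat - fstar \<le> eps0 / (a * N + 1) powr (\<rho> / \<tau>)"
      using gap_R by linarith
  next
    assume "\<tau> > 0"
    then have "a > 0" "\<rho> / \<tau> \<ge> 0"
      using pos eps0(1) by (auto simp: a_def)
    from inverse_affine_powr_bigo[OF this, of eps0]
    show "(\<lambda>M. eps0 / (a * M + 1) powr (\<rho> / \<tau>)) \<in> O[at_top](\<lambda>M. M powr (- \<rho> / \<tau>))"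
      by simp
  qed
qed

end
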